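(* Let $k \geq 4$ be an integer with $k \equiv 2 \pmod{4}$. Then the power series $1/\mathrm{E}_k(q) = \sum_{n=0}^{\infty} \beta_k(n)\, q^n$ has radius of convergence $q_i = e^{-2\pi}$. The coefficients $\beta_k(n)$ are non-zero and satisfy the asymptotic expansion \[ \beta_k(n) \sim -\frac{1}{\Theta(\mathrm{E}_k)(q_i)}\, q_i^{-n} \qquad (n \to \infty). \]
   Context: For an even integer $k \geq 2$, $B_k$ denotes the $k$-th Bernoulli number and $\sigma_{\ell}(n) = \sum_{d \mid n} d^{\ell}$. The Eisenstein series of weight $k$ is the power series $\mathrm{E}_k(q) = 1 - \frac{2k}{B_k}\sum_{n=1}^{\infty} \sigma_{k-1}(n)\, q^n$, so that $E_k(z) = \mathrm{E}_k(e^{2\pi i z})$ for $z$ in the upper half plane. For $z$ in the upper half plane, $q_z := e^{2\pi i z}$; in particular $q_i = e^{-2\pi}$. The numbers $\beta_k(n)$ are the coefficients of the power series expansion of $1/\mathrm{E}_k(q)$ around $q=0$. $\Theta = q\frac{\mathrm{d}}{\mathrm{d}q}$ acts on power series by $\Theta\left(\sum a(n) q^n\right) = \sum n\, a(n) q^n$, and $\Theta(\mathrm{E}_k)(q_i)$ denotes the value of the power series $\Theta(\mathrm{E}_k)$ at $q = q_i$. *)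

theory Defs
  imports
    "HOL-Analysis.Analysis"
    "HOL-Library.Landau_Symbols"
    "HOL-Number_Theory.Cong"
begin

(* Generating function x / (e^x - 1), so that B_1 = -1/2. *)
definition bernoulli :: "nat \<Rightarrow> real" where
  "bernoulli k = fact k * fps_nth (fps_X / (fps_exp 1 - 1)) k"

definition divisor_sigma :: "nat \<Rightarrow> nat \<Rightarrow> nat" where
  "divisor_sigma l n = (\<Sum>d | d dvd n. d ^ l)"

(* The operator Theta = q d/dq on power series is fps_XD, see fps_XD_nth. *)

(* Meaningful for even k \<ge> 2, where B_k is non-zero. *)
definition E_fps :: "nat \<Rightarrow> complex fps" where
  "E_fps k = Abs_fps (\<lambda>n. if n = 0 then 1
     else - (of_real (2 * real k / bernoulli k)) * of_nat (divisor_sigma (k - 1) n))"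

definition beta :: "nat \<Rightarrow> nat \<Rightarrow> complex" where
  "beta k n = fps_nth (inverse (E_fps k)) n"

definition q_at :: "complex \<Rightarrow> complex" where
  "q_at z = exp (2 * of_real pi * \<i> * z)"

lemma q_at_ii: "q_at \<i> = of_real (exp (- 2 * pi))"
proof -
  have "2 * of_real pi * \<i> * \<i> = (of_real (- 2 * pi) :: complex)"
    by (simp add: mult.assoc)
  then show ?thesis
    unfolding q_at_def by (metis exp_of_real)
qed

lemma bernoulli_fps:
  "Abs_fps (\<lambda>k. bernoulli k / fact k) * (fps_exp 1 - 1) = fps_X"
proof -
  define D where "D = (fps_exp 1 - 1 :: real fps)"
  have D_nth: "fps_nth D m = (if m = 0 then 0 else 1 / fact m)" for m
    by (simp add: D_def)
  have "D \<noteq> 0"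
    using D_nth[of 1] by (metis fps_zero_nth fact_1 div_by_1 one_neq_zero)
  moreover have "subdegree D = 1"
    by (intro subdegreeI) (auto simp: D_nth)
  ultimately have "fps_X / D * D = fps_X"
    by (intro dvd_div_mult_self) (simp add: fps_dvd_iff)
  moreover have "Abs_fps (\<lambda>k. bernoulli k / fact k) = fps_X / D"
    by (simp add: fps_eq_iff bernoulli_def D_def)
  ultimately show ?thesis
    by (simp add: D_def)
qed

lemma bernoulli_0: "bernoulli 0 = 1"
  using arg_cong[OF bernoulli_fps, of "\<lambda>f. fps_nth f 1"]
  by (simp add: fps_mult_nth)

lemma bernoulli_recurrence:
  assumes "n \<ge> 2"
  shows "(\<Sum>k<n. real (n choose k) * bernoulli k) = 0"
proof -
  have "0 = fps_nth (Abs_fps (\<lambda>k. bernoulli k / fact k) * (fps_exp 1 - 1)) n"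
    using assms by (simp add: bernoulli_fps)
  also have "\<dots> = (\<Sum>k\<le>n. bernoulli k / fact k * fps_nth (fps_exp 1 - 1) (n - k))"
    by (simp add: fps_mult_nth atLeast0AtMost)
  also have "\<dots> = (\<Sum>k<n. bernoulli k / fact k * fps_nth (fps_exp 1 - 1) (n - k))"
    by (simp add: fps_mult_nth atLeast0AtMost lessThan_Suc_atMost[symmetric] mult.commute)
  also have "\<dots> = (\<Sum>k<n. real (n choose k) * bernoulli k / fact n)"
    by (rule sum.cong[OF refl]) (simp add: binomial_fact mult.commute)
  also have "\<dots> = (\<Sum>k<n. real (n choose k) * bernoulli k) / fact n"
    by (simp add: sum_divide_distrib)
  finally show ?thesis by simp
qed

end

(*
  For k = 2 (mod 4) the modular symmetry under z -> -1/z gives E_k(q_i) = 0, that is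
  sum_n sigma_{k-1}(n) q_i^n = B_k / (2k).  This is obtained here from an elliptic function: with
  L(w) = sum_d d q_i^d / (1 - q_i^d) w^d, the function
  F(s) = e^s / (e^s - 1)^2 + L(e^s) + L(e^-s) has periods 2 pi and 2 pi i and principal part 1/s^2
  at 0, so H(s) = F(s) + F(i s) has no poles and, attaining its maximum modulus on a fundamental
  square, is constant.  The Taylor coefficient of F at s^(k-2) is doubled in H because
  i^(k-2) = 1, hence it vanishes, and this is the identity.  The left-hand side being positive,
  also B_k > 0.

  Now E_k = 1 - sum_n c_n q^n with all c_n > 0.  The recursion for 1/E_k shows that all its
  coefficients are positive, and comparing real parts of sum_n c_n q^n shows that q_i is the only
  zero of E_k in the closed disc of radius q_i; it is simple since the derivative there is
  negative.  So 1/E_k has a single simple pole on that disc.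
*)
theory Submission
  imports Defs "HOL-Complex_Analysis.Complex_Analysis"
begin

subsection \<open>Power series and Lambert series\<close>

lemma fps_conv_radius_XD:
  fixes F :: "'a :: {banach, real_normed_field} fps"
  shows "fps_conv_radius (fps_XD F) \<ge> fps_conv_radius F"
proof -
  have "fps_conv_radius (fps_X * fps_deriv F) \<ge> min (fps_conv_radius (fps_X :: 'a fps)) (fps_conv_radius (fps_deriv F))"
    by (rule fps_conv_radius_mult)
  moreover have "fps_conv_radius (fps_deriv F) \<ge> fps_conv_radius F"
    by (rule fps_conv_radius_deriv)
  ultimately show ?thesis
    by (simp add: fps_XD_def)
qed

lemma eval_fps_XD:
  fixes F :: "'a :: {banach, real_normed_field} fps"
  assumes "norm z < fps_conv_radius F"
  shows "eval_fps (fps_XD F) z = z * deriv (eval_fps F) z"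
proof -
  have "norm z < fps_conv_radius (fps_deriv F)"
    using assms fps_conv_radius_deriv[of F] by order
  then show ?thesis
    using assms by (simp add: fps_XD_def eval_fps_mult eval_fps_deriv)
qed

text \<open>Under q = e^s, d/ds becomes q d/dq. Each derivative has the same shape with
  \<open>fps_XD F\<close> in place of \<open>F\<close>, whose radius is no smaller, so the induction
  keeps \<open>F\<close> arbitrary.\<close>

lemma higher_deriv_eval_fps_exp:
  fixes F :: "complex fps"
  assumes "norm (exp s) < fps_conv_radius F"
  shows "(deriv ^^ n) (\<lambda>s. eval_fps F (exp s)) s = eval_fps ((fps_XD ^^ n) F) (exp s)"
  using assms
proof (induction n arbitrary: F)
  case (Suc n F)
  define S where "S = exp -` eball (0 :: complex) (fps_conv_radius F)"
  have "open S"
    unfolding S_def by (intro continuous_open_vimage) (auto intro!: continuous_intros)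
  have "s \<in> S"
    using Suc.prems by (auto simp: S_def)
  have D: "deriv (\<lambda>s. eval_fps F (exp s)) t = eval_fps (fps_XD F) (exp t)" if "t \<in> S" for t
  proof (rule DERIV_imp_deriv)
    have t: "norm (exp t) < fps_conv_radius F"
      using that by (simp add: S_def)
    have "((\<lambda>s. eval_fps F (exp s)) has_field_derivative eval_fps (fps_deriv F) (exp t) * exp t) (at t)"
      by (rule DERIV_chain2[OF has_field_derivative_eval_fps[OF t] DERIV_exp])
    also have "eval_fps (fps_deriv F) (exp t) * exp t = eval_fps (fps_XD F) (exp t)"
      using t by (simp add: eval_fps_XD eval_fps_deriv)
    finally show "((\<lambda>s. eval_fps F (exp s)) has_field_derivative eval_fps (fps_XD F) (exp t)) (at t)" .
  qed
  have "(deriv ^^ Suc n) (\<lambda>s. eval_fps F (exp s)) s = (deriv ^^ n) (deriv (\<lambda>s. eval_fps F (exp s))) s"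
    by (simp add: funpow_swap1)
  also have "\<dots> = (deriv ^^ n) (\<lambda>s. eval_fps (fps_XD F) (exp s)) s"
    using D \<open>open S\<close> \<open>s \<in> S\<close>
    by (intro higher_deriv_cong_ev refl) (auto intro: eventually_mono[OF eventually_nhds_in_open])
  also have "\<dots> = eval_fps ((fps_XD ^^ n) (fps_XD F)) (exp s)"
    using Suc.prems fps_conv_radius_XD[of F] by (intro Suc.IH) order
  finally show ?case
    by (simp add: funpow_swap1)
qed simp

section \<open>Lambert series at q_i\<close>

definition qi :: real where "qi = exp (- 2 * pi)"

lemma qi_pos: "qi > 0" and qi_less_1: "qi < 1"
  by (simp_all add: qi_def)

lemma qi_power_less_1: "n > 0 \<Longrightarrow> qi ^ n < 1"
  using qi_pos qi_less_1 by (simp add: power_less_one_iff)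

text \<open>At 1 this evaluates to sum_d d^j q_i^d / (1 - q_i^d); for j = 1 it is the series L. The
  coefficient at d = 0 is a division by zero, hence 0.\<close>

definition lambert_fps :: "nat \<Rightarrow> complex fps" where
  "lambert_fps j = Abs_fps (\<lambda>d. of_real (real d ^ j * qi ^ d / (1 - qi ^ d)))"

lemma fps_XD_lambert: "fps_XD (lambert_fps j) = lambert_fps (Suc j)"
  by (rule fps_ext) (simp add: lambert_fps_def fps_XD_nth)

lemma fps_XD_funpow_lambert: "(fps_XD ^^ n) (lambert_fps j) = lambert_fps (n + j)"
  by (induction n) (simp_all add: fps_XD_lambert)

text \<open>For j = 0 the terms are dominated by a geometric series, since 1 - q_i^d >= 1 - q_i for
  d > 0; applying q d/dq raises j without shrinking the radius. As 1 / q_i = e^(2 pi), substituting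
  e^s is allowed for Re s < 2 pi.\<close>

lemma conv_radius_lambert: "fps_conv_radius (lambert_fps j) \<ge> ereal (1 / qi)"
proof (induction j)
  case 0
  show ?case
    unfolding fps_conv_radius_def
  proof (rule conv_radius_geI_ex')
    fix r :: real assume r: "r > 0" "ereal r < ereal (1 / qi)"
    have lt: "qi * r < 1"
      using r qi_pos by (simp add: field_simps)
    have bound: "norm (fps_nth (lambert_fps 0) n * of_real r ^ n) \<le> (qi * r) ^ n / (1 - qi)" for n
    proof (cases "n = 0")
      case True
      then show ?thesis using qi_less_1 by (simp add: lambert_fps_def)
    next
      case False
      then have "qi ^ n \<le> qi"
        using power_decreasing[of 1 n qi] qi_pos qi_less_1 by simp
      then have "(qi * r) ^ n / (1 - qi ^ n) \<le> (qi * r) ^ n / (1 - qi)"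
        using r qi_pos qi_less_1 by (intro divide_left_mono mult_pos_pos) auto
      moreover have "fps_nth (lambert_fps 0) n * of_real r ^ n = of_real ((qi * r) ^ n / (1 - qi ^ n))"
        by (simp add: lambert_fps_def power_mult_distrib)
      then have "norm (fps_nth (lambert_fps 0) n * of_real r ^ n) = \<bar>(qi * r) ^ n / (1 - qi ^ n)\<bar>"
        by (simp only: norm_of_real)
      moreover have "0 \<le> (qi * r) ^ n / (1 - qi ^ n)"
        using r qi_pos \<open>qi ^ n \<le> qi\<close> qi_less_1 by (intro divide_nonneg_nonneg) auto
      ultimately show ?thesis by (simp only: abs_of_nonneg)
    qed
    have "summable (\<lambda>n. (qi * r) ^ n / (1 - qi))"
      using r qi_pos lt by (intro summable_divide summable_geometric) simp
    then show "summable (\<lambda>n. fps_nth (lambert_fps 0) n * of_real r ^ n)"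
      by (rule summable_comparison_test') (rule bound)
  qed
next
  case (Suc j)
  then show ?case
    using fps_conv_radius_XD[of "lambert_fps j"] by (simp add: fps_XD_lambert)
qed

lemma lambert_sums:
  assumes "norm z < 1 / qi"
  shows "(\<lambda>d. of_real (real d ^ j * qi ^ d / (1 - qi ^ d)) * z ^ d) sums eval_fps (lambert_fps j) z"
  using sums_eval_fps[of z "lambert_fps j"] conv_radius_lambert[of j] assms
  by (simp add: lambert_fps_def order_less_le_trans[of "ereal (norm z)" "ereal (1 / qi)"])

lemma sums_nat_times_power:
  fixes z :: "'a :: {real_normed_field, banach}"
  assumes "norm z < 1"
  shows "(\<lambda>n. of_nat n * z ^ n) sums (z / (1 - z)\<^sup>2)"
proof -
  have "(\<lambda>n. z * (of_nat (Suc n) * z ^ n)) sums (z * (1 / (1 - z)\<^sup>2))"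
    by (intro sums_mult geometric_deriv_sums assms)
  then have "(\<lambda>n. of_nat (Suc n) * z ^ Suc n) sums (z / (1 - z)\<^sup>2)"
    by (simp add: algebra_simps)
  then show ?thesis
    by (subst (asm) sums_Suc_iff) simp
qed

text \<open>
  The series is symmetric in \<open>v\<close> and \<open>w\<close> but its value is not visibly so: for \<open>v = q\<^sub>i e\<^sup>s\<close> and
  \<open>w = e\<^sup>-\<^sup>s\<close>, exchanging them is the translation of \<open>s\<close> by \<open>2\<pi>\<close>.
\<close>
lemma lambert_symmetric_sums:
  assumes "norm v < 1" "norm w < 1"
  shows "(\<lambda>d. of_real (real d / (1 - qi ^ d)) * (v ^ d + w ^ d)) sums
    (w / (1 - w)\<^sup>2 + eval_fps (lambert_fps 1) (v / of_real qi) + eval_fps (lambert_fps 1) w)"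
proof -
  have "norm (v / of_real qi) < 1 / qi"
    using assms qi_pos by (simp add: norm_divide divide_strict_right_mono)
  moreover have "norm w < 1 / qi"
    using assms qi_pos qi_less_1 less_trans[of "norm w" 1 "1 / qi"] by simp
  \<comment> \<open>Since 1 / (1 - q_i^d) = 1 + q_i^d / (1 - q_i^d), the w-part splits into sum_d d
    w^d = w / (1 - w)^2 and a Lambert series. In the v-part the factor q_i^d is absorbed by dividing
    v by q_i.\<close>
  ultimately have "(\<lambda>d. of_nat d * w ^ d
      + of_real (real d ^ 1 * qi ^ d / (1 - qi ^ d)) * (v / of_real qi) ^ d
      + of_real (real d ^ 1 * qi ^ d / (1 - qi ^ d)) * w ^ d) sums
    (w / (1 - w)\<^sup>2 + eval_fps (lambert_fps 1) (v / of_real qi) + eval_fps (lambert_fps 1) w)"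
    using assms by (intro sums_add sums_nat_times_power lambert_sums)
  also have "(\<lambda>d. of_nat d * w ^ d
      + of_real (real d ^ 1 * qi ^ d / (1 - qi ^ d)) * (v / of_real qi) ^ d
      + of_real (real d ^ 1 * qi ^ d / (1 - qi ^ d)) * w ^ d)
    = (\<lambda>d. of_real (real d / (1 - qi ^ d)) * (v ^ d + w ^ d))"
  proof
    fix d
    show "of_nat d * w ^ d
      + of_real (real d ^ 1 * qi ^ d / (1 - qi ^ d)) * (v / of_real qi) ^ d
      + of_real (real d ^ 1 * qi ^ d / (1 - qi ^ d)) * w ^ d
     = of_real (real d / (1 - qi ^ d)) * (v ^ d + w ^ d)"
    proof (cases "d = 0")
      case False
      define a where "a = (of_real qi :: complex) ^ d"
      have "qi ^ d \<noteq> 1" "qi ^ d \<noteq> 0"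
        using qi_power_less_1[of d] qi_pos False by auto
      then have "a \<noteq> 0" "1 - a \<noteq> 0"
        unfolding a_def by (metis of_real_power of_real_eq_0_iff, metis of_real_power of_real_eq_1_iff right_minus_eq)
      then have "n * y + n * a / (1 - a) * (x / a) + n * a / (1 - a) * y = n / (1 - a) * (x + y)" for n x y
        by (simp add: divide_simps) (simp add: algebra_simps)
      then show ?thesis
        by (simp add: power_divide flip: a_def)
    qed simp
  qed
  finally show ?thesis .
qed

text \<open>
  Up to additive and multiplicative constants this is the Weierstrass function of the lattice
  \<open>2\<pi>\<int>[\<i>]\<close>, restricted to the strip \<open>\<bar>Re s\<bar> < 2\<pi>\<close> where the Lambert series converge.
\<close>
definition lattice_sum :: "complex \<Rightarrow> complex" where
  "lattice_sum s = exp s / (exp s - 1)\<^sup>2 + (eval_fps (lambert_fps 1) (exp s) + eval_fps (lambert_fps 1) (exp (- s)))"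

lemma exp_kernel_even: "exp (- s) / (exp (- s) - 1)\<^sup>2 = exp s / (exp s - 1)\<^sup>2" for s :: complex
proof -
  have "exp (- s) - 1 = - exp (- s) * (exp s - 1)"
    by (simp add: algebra_simps exp_minus_inverse flip: exp_add)
  then have "exp (- s) / (exp (- s) - 1)\<^sup>2 = exp (- s) / (exp (- s) ^ 2 * (exp s - 1)\<^sup>2)"
    by (simp add: power_mult_distrib)
  also have "\<dots> = exp s / (exp s - 1)\<^sup>2"
    by (simp add: power2_eq_square exp_minus field_simps)
  finally show ?thesis .
qed

text \<open>The bounds on Re s say exactly that v = q_i e^s and w = e^-s have norm below 1. The
  values at s and s - 2 pi are then the two evaluations of the symmetric series.\<close>

lemma lattice_sum_shift_real:
  assumes "0 < Re s" "Re s < 2 * pi"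
  shows "lattice_sum (s - 2 * pi) = lattice_sum s"
proof -
  define v where "v = exp (s - 2 * pi)"
  define w where "w = exp (- s)"
  have "exp (complex_of_real (2 * pi)) * of_real qi = 1"
    unfolding qi_def exp_of_real[symmetric] by (simp flip: exp_add)
  then have qi: "exp s = v / of_real qi" "exp (- (s - 2 * pi)) = w / of_real qi"
    using qi_pos by (auto simp: v_def w_def exp_diff exp_minus field_simps)
  have "norm v < 1" "norm w < 1"
    using assms by (simp_all add: v_def w_def)
  note sums = lambert_symmetric_sums[OF this] lambert_symmetric_sums[OF this(2,1)]
  have "w / (1 - w)\<^sup>2 + eval_fps (lambert_fps 1) (v / of_real qi) + eval_fps (lambert_fps 1) w
      = v / (1 - v)\<^sup>2 + eval_fps (lambert_fps 1) (w / of_real qi) + eval_fps (lambert_fps 1) v"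
    using sums by (intro sums_unique2) (simp_all add: add.commute)
  moreover have "exp s / (exp s - 1)\<^sup>2 = w / (1 - w)\<^sup>2"
    using exp_kernel_even[of s] by (simp add: w_def power2_commute)
  moreover have "exp (s - of_real (2 * pi)) / (exp (s - of_real (2 * pi)) - 1)\<^sup>2 = v / (1 - v)\<^sup>2"
    by (simp only: v_def power2_commute)
  ultimately show ?thesis
    unfolding lattice_sum_def qi w_def[symmetric] unfolding v_def[symmetric] by (simp add: add_ac)
qed

lemma lattice_sum_shift_imag: "lattice_sum (s - of_real (2 * pi) * \<i>) = lattice_sum s"
proof -
  have "exp (s - of_real (2 * pi) * \<i>) = exp s" "exp (- s + of_real (2 * pi) * \<i>) = exp (- s)"
    by (simp_all add: exp_diff exp_add exp_minus inverse_eq_divide)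
  then show ?thesis
    unfolding lattice_sum_def minus_diff_eq diff_conv_add_uminus[of "of_real (2 * pi) * \<i>"]
      add.commute[of "of_real (2 * pi) * \<i>"] by (simp only:)
qed

subsection \<open>The elliptic function argument\<close>

text \<open>Invariance under rotation by a right angle makes one period enough. Every value on the
  open square \<open>Q\<close> is already taken on the closed square \<open>C\<close> of half the
  size, so the maximum over the compact \<open>C\<close> is a maximum over \<open>Q\<close>,
  attained in its interior.\<close>

lemma constant_on_square_if_periodic:
  fixes H :: "complex \<Rightarrow> complex" and p :: real
  defines "Q \<equiv> {s. \<bar>Re s\<bar> < 2 * p \<and> \<bar>Im s\<bar> < 2 * p}"
  assumes "p > 0" and holo: "H holomorphic_on Q"
    and rot: "\<And>s. s \<in> Q \<Longrightarrow> H (\<i> * s) = H s"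
    and shift: "\<And>s. s \<in> Q \<Longrightarrow> Re s > 0 \<Longrightarrow> H (s - of_real (2 * p)) = H s"
  shows "H constant_on Q"
proof -
  define C where "C = cbox (Complex (-p) (-p)) (Complex p p)"
  have C: "s \<in> C \<longleftrightarrow> \<bar>Re s\<bar> \<le> p \<and> \<bar>Im s\<bar> \<le> p" for s
    by (auto simp: C_def in_cbox_complex_iff)
  have rotQ: "\<i> * s \<in> Q" if "s \<in> Q" for s
    using that by (auto simp: Q_def)
  have reflect: "H (-s) = H s" if "s \<in> Q" for s
    using rot[OF that] rot[OF rotQ[OF that]] by (simp flip: mult.assoc)
  \<comment> \<open>The shift is only available for Re s > 0, where it stays in \<open>Q\<close>;
    negative real parts are first reflected. The size of the imaginary part is kept, so that a
    second reduction after a rotation does not undo the first.\<close>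
  have reduce: "\<exists>t. \<bar>Re t\<bar> \<le> p \<and> \<bar>Im t\<bar> = \<bar>Im s\<bar> \<and> t \<in> Q \<and> H t = H s" if s: "s \<in> Q" for s
  proof -
    consider "\<bar>Re s\<bar> \<le> p" | "Re s > p" | "Re s < -p" by linarith
    then show ?thesis
    proof cases
      case 1
      then show ?thesis using s by blast
    next
      case 2
      then show ?thesis
        using s shift[of s] \<open>p > 0\<close> by (intro exI[of _ "s - of_real (2 * p)"]) (auto simp: Q_def)
    next
      case 3
      then show ?thesis
        using s shift[of "-s"] reflect[of s] \<open>p > 0\<close>
        by (intro exI[of _ "- s - of_real (2 * p)"]) (auto simp: Q_def)
    qed
  qed
  have fund: "\<exists>t\<in>C. H t = H s" if s: "s \<in> Q" for s
  proof -
    from reduce[OF s] obtain t where t: "\<bar>Re t\<bar> \<le> p" "t \<in> Q" "H t = H s" by blast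
    from reduce[OF rotQ[OF t(2)]] obtain u where "\<bar>Re u\<bar> \<le> p" "\<bar>Im u\<bar> = \<bar>Re t\<bar>" "H u = H (\<i> * t)"
      by auto
    then show ?thesis
      using t rot[OF t(2)] by (intro bexI[of _ u]) (auto simp: C)
  qed
  have "C \<subseteq> Q"
    using \<open>p > 0\<close> by (auto simp: C Q_def)
  have Q_eq: "Q = box (Complex (-2*p) (-2*p)) (Complex (2*p) (2*p))"
    by (auto simp: Q_def in_box_complex_iff)
  have "continuous_on C (\<lambda>s. norm (H s))"
    using holo \<open>C \<subseteq> Q\<close> by (intro continuous_on_norm holomorphic_on_imp_continuous_on) (rule holomorphic_on_subset)
  moreover have "compact C" "C \<noteq> {}"
    using \<open>p > 0\<close> C[of 0] by (auto simp: C_def)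
  ultimately obtain \<xi> where \<xi>: "\<xi> \<in> C" "\<And>s. s \<in> C \<Longrightarrow> norm (H s) \<le> norm (H \<xi>)"
    using continuous_attains_sup[of C "\<lambda>s. norm (H s)"] by blast
  show ?thesis
  proof (rule maximum_modulus_principle[OF holo _ _ _ subset_refl])
    show "open Q" "open Q" "connected Q"
      unfolding Q_eq by (auto intro: convex_connected)
    show "\<xi> \<in> Q"
      using \<xi> \<open>C \<subseteq> Q\<close> by blast
    show "norm (H s) \<le> norm (H \<xi>)" if "s \<in> Q" for s
      using fund[OF that] \<xi> by metis
  qed
qed

section \<open>Taylor coefficients of the kernel at the origin\<close>

definition bernoulli_gf :: "complex fps" where
  "bernoulli_gf = Abs_fps (\<lambda>k. of_real (bernoulli k / fact k))"

lemma bernoulli_gf_mult: "bernoulli_gf * (fps_exp 1 - 1) = fps_X"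
proof (rule fps_ext)
  fix n
  have "fps_nth (bernoulli_gf * (fps_exp 1 - 1)) n
      = of_real (fps_nth (Abs_fps (\<lambda>k. bernoulli k / fact k) * (fps_exp 1 - 1)) n)"
    by (simp add: bernoulli_gf_def fps_mult_nth of_real_sum del: of_real_divide)
       (intro sum.cong refl, auto simp: fps_one_def)
  then show "fps_nth (bernoulli_gf * (fps_exp 1 - 1)) n = fps_nth fps_X n"
    by (simp add: bernoulli_fps)
qed

text \<open>With b(s) = s / (e^s - 1), expanded by \<open>bernoulli_gf\<close>, b^2 e^s - 1 is s^2
  times e^s / (e^s - 1)^2 - 1 / s^2; the shift divides by s^2.\<close>

definition kernel_fps :: "complex fps" where
  "kernel_fps = fps_shift 2 (bernoulli_gf ^ 2 * fps_exp 1 - 1)"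

text \<open>
  \<^term>\<open>exp s / (exp s - 1)\<^sup>2\<close> is minus the derivative of \<^term>\<open>1 / (exp s - 1)\<close>, which is how its Taylor
  coefficients come to be Bernoulli numbers.
\<close>
definition kernel_reg :: "complex \<Rightarrow> complex" where
  "kernel_reg s = (if s = 0 then fps_nth kernel_fps 0 else exp s / (exp s - 1)\<^sup>2 - 1 / s\<^sup>2)"

text \<open>Differentiating b (e^s - 1) = s and multiplying by b gives s b' + b^2 e^s = b. The
  square is thereby replaced by a linear expression whose coefficients can be read off.\<close>

lemma bernoulli_gf_square:
  "bernoulli_gf ^ 2 * fps_exp 1 - 1 = bernoulli_gf - 1 - fps_XD bernoulli_gf"
proof -
  have "fps_deriv (bernoulli_gf * (fps_exp 1 - 1)) = 1"
    by (simp only: bernoulli_gf_mult fps_deriv_fps_X)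
  then have "bernoulli_gf * (fps_deriv bernoulli_gf * (fps_exp 1 - 1) + bernoulli_gf * fps_exp 1) = bernoulli_gf"
    by (simp add: algebra_simps)
  also have "bernoulli_gf * (fps_deriv bernoulli_gf * (fps_exp 1 - 1) + bernoulli_gf * fps_exp 1)
      = fps_deriv bernoulli_gf * (bernoulli_gf * (fps_exp 1 - 1)) + bernoulli_gf ^ 2 * fps_exp 1"
    by (simp add: algebra_simps power2_eq_square)
  finally show ?thesis
    unfolding bernoulli_gf_mult by (simp add: fps_XD_def algebra_simps)
qed

lemma kernel_fps_nth:
  "fps_nth kernel_fps n = - of_real (real (n + 1) * bernoulli (n + 2) / fact (n + 2))"
  unfolding kernel_fps_def bernoulli_gf_square
  by (simp add: bernoulli_gf_def field_simps del: fact_Suc)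

lemma kernel_reg_has_fps_expansion: "kernel_reg has_fps_expansion kernel_fps"
proof -
  define b where "b = (\<lambda>s :: complex. if s = 0 then 1 else s / (exp s - 1))"
  have sub: "subdegree (fps_exp 1 - 1 :: complex fps) = 1"
    by (intro subdegreeI) auto
  then have nz: "(fps_exp 1 - 1 :: complex fps) \<noteq> 0"
    by auto
  have "b has_fps_expansion (fps_X / (fps_exp 1 - 1))"
    unfolding b_def
    by (intro has_fps_expansion_divide has_fps_expansion_fps_X has_fps_expansion_diff
        has_fps_expansion_exp1 has_fps_expansion_1 nz) (use sub in simp_all)
  also have "fps_X / (fps_exp 1 - 1) = bernoulli_gf"
    using nz by (simp flip: bernoulli_gf_mult)
  finally have b: "b has_fps_expansion bernoulli_gf" .
  have "(\<lambda>s. b s ^ 2 * exp s - 1) has_fps_expansion bernoulli_gf ^ 2 * fps_exp 1 - 1"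
    unfolding power2_eq_square
    by (intro has_fps_expansion_diff has_fps_expansion_mult has_fps_expansion_exp1 has_fps_expansion_1 b)
  moreover have "2 \<le> subdegree (bernoulli_gf ^ 2 * fps_exp 1 - 1)"
  proof (rule subdegree_geI)
    have "fps_nth (bernoulli_gf ^ 2 * fps_exp 1 - 1) 2 = - of_real (bernoulli 2 / 2)"
      using kernel_fps_nth[of 0] by (simp add: kernel_fps_def eval_nat_numeral)
    \<comment> \<open>The zero series has subdegree 0, so the bound requires a non-zero coefficient.
      The recurrences for n = 2 and n = 3 rule out B_2 = 0.\<close>
    moreover have "bernoulli 2 \<noteq> 0"
    proof
      assume "bernoulli 2 = 0"
      then show False
        using bernoulli_recurrence[of 2] bernoulli_recurrence[of 3] bernoulli_0
        by (simp add: eval_nat_numeral)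
    qed
    ultimately show "bernoulli_gf ^ 2 * fps_exp 1 - 1 \<noteq> 0"
      by force
    show "fps_nth (bernoulli_gf ^ 2 * fps_exp 1 - 1) i = 0" if "i < 2" for i
      using that bernoulli_0 unfolding bernoulli_gf_square by (auto simp: bernoulli_gf_def less_2_cases_iff)
  qed
  ultimately have "(\<lambda>s. if s = 0 then fps_nth (bernoulli_gf ^ 2 * fps_exp 1 - 1) 2 else (b s ^ 2 * exp s - 1) / s ^ 2)
      has_fps_expansion kernel_fps"
    unfolding kernel_fps_def by (intro has_fps_expansion_shift) auto
  also have "(\<lambda>s. if s = 0 then fps_nth (bernoulli_gf ^ 2 * fps_exp 1 - 1) 2 else (b s ^ 2 * exp s - 1) / s ^ 2) = kernel_reg"
    by (rule ext) (simp add: kernel_reg_def kernel_fps_def b_def power_divide diff_divide_distrib eval_nat_numeral)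
  finally show ?thesis .
qed

text \<open>The poles of the kernel are the multiples of 2 pi i. Only 0 lies in this strip, and
  there the power series expansion gives analyticity.\<close>

lemma kernel_reg_analytic:
  assumes "\<bar>Im s\<bar> < 2 * pi"
  shows "kernel_reg analytic_on {s}"
proof (cases "s = 0")
  case True
  then show ?thesis
    using has_fps_expansion_imp_analytic_0[OF kernel_reg_has_fps_expansion] by simp
next
  case False
  then have "exp s \<noteq> 1"
    using assms exp_complex_eqI[of s 0] by auto
  then have "(\<lambda>s. exp s / (exp s - 1)\<^sup>2 - 1 / s\<^sup>2) analytic_on {s}"
    using False by (intro analytic_intros) auto
  moreover have "eventually (\<lambda>t. kernel_reg t = exp t / (exp t - 1)\<^sup>2 - 1 / t\<^sup>2) (nhds s)"
    using False by (intro eventually_mono[OF t1_space_nhds[of s 0]]) (auto simp: kernel_reg_def)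
  ultimately show ?thesis
    by (subst analytic_at_cong[of _ "\<lambda>t. exp t / (exp t - 1)\<^sup>2 - 1 / t\<^sup>2"]) auto
qed

lemma kernel_reg_even: "kernel_reg (- s) = kernel_reg s"
  by (simp add: kernel_reg_def exp_kernel_even)

section \<open>The Lambert part and the Bernoulli identity\<close>

definition lambert_even :: "complex \<Rightarrow> complex" where
  "lambert_even s = eval_fps (lambert_fps 1) (exp s) + eval_fps (lambert_fps 1) (exp (- s))"

lemma lambert_even_analytic:
  assumes "\<bar>Re s\<bar> < 2 * pi"
  shows "lambert_even analytic_on {s}"
proof -
  have "norm (exp s) < 1 / qi" "norm (exp (- s)) < 1 / qi"
    using assms by (auto simp: qi_def exp_minus simp flip: exp_minus inverse_eq_divide)
  then have "norm (exp s) < fps_conv_radius (lambert_fps 1)" "norm (exp (- s)) < fps_conv_radius (lambert_fps 1)"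
    using conv_radius_lambert[of 1] less_ereal.simps(1) order_less_le_trans by blast+
  then have "(eval_fps (lambert_fps 1) \<circ> exp) analytic_on {s}" "(eval_fps (lambert_fps 1) \<circ> (\<lambda>s. exp (- s))) analytic_on {s}"
    by (auto intro!: analytic_on_compose analytic_on_eval_fps analytic_intros)
  then show ?thesis
    unfolding lambert_even_def by (intro analytic_on_add) (auto simp: o_def)
qed

text \<open>For even n the summands f(s) and f(-s) have the same n-th derivative at 0. By the
  substitution q = e^s it is the value at 1 of (q d/dq)^n applied to L.\<close>

lemma higher_deriv_lambert_even:
  assumes "even n"
  shows "(deriv ^^ n) lambert_even 0 = 2 * eval_fps (lambert_fps (Suc n)) 1"
proof -
  define f where "f = (\<lambda>s. eval_fps (lambert_fps 1) (exp s))"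
  define S where "S = exp -` eball (0 :: complex) (fps_conv_radius (lambert_fps 1))"
  have "1 / qi > 1"
    using qi_pos qi_less_1 by simp
  then have rad: "1 < fps_conv_radius (lambert_fps 1)"
    using conv_radius_lambert[of 1] order_less_le_trans[of 1 "ereal (1 / qi)"] by (simp add: one_ereal_def)
  have "open S"
    unfolding S_def by (intro continuous_open_vimage) (auto intro!: continuous_intros)
  have "0 \<in> S"
    using rad by (simp add: S_def zero_ereal_def one_ereal_def)
  have "eval_fps (lambert_fps 1) \<circ> exp holomorphic_on S"
    by (intro holomorphic_on_compose holomorphic_on_eval_fps holomorphic_intros) (auto simp: S_def)
  then have f: "f holomorphic_on S"
    by (simp add: f_def o_def)
  have opn: "open (uminus -` S)" and z: "0 \<in> uminus -` S"
    using \<open>open S\<close> \<open>0 \<in> S\<close> by (auto intro!: continuous_open_vimage continuous_intros)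
  have f': "(\<lambda>s. f (- s)) holomorphic_on (uminus -` S)"
    using holomorphic_on_compose_gen[OF holomorphic_on_minus[OF holomorphic_on_ident] f, of "uminus -` S"]
    by (auto simp: o_def)
  have d: "(deriv ^^ n) f 0 = eval_fps (lambert_fps (Suc n)) 1"
    using higher_deriv_eval_fps_exp[of 0 "lambert_fps 1" n] rad
    by (simp add: f_def fps_XD_funpow_lambert one_ereal_def)
  have "(deriv ^^ n) (\<lambda>s. f (- s)) 0 = (deriv ^^ n) f 0"
    using higher_deriv_compose_linear[OF f opn \<open>open S\<close> z, of "-1" n] assms by simp
  moreover have "(deriv ^^ n) (\<lambda>s. f s + f (- s)) 0 = (deriv ^^ n) f 0 + (deriv ^^ n) (\<lambda>s. f (- s)) 0"
    using f f' \<open>open S\<close> opn \<open>0 \<in> S\<close> z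
    by (intro higher_deriv_add_at) (auto simp: analytic_at)
  moreover have "lambert_even = (\<lambda>s. f s + f (- s))"
    by (simp add: lambert_even_def f_def fun_eq_iff)
  ultimately show ?thesis
    using d by simp
qed

lemma lambert_value:
  assumes "n > 0" "4 dvd n"
  shows "eval_fps (lambert_fps (Suc n)) 1 = of_real (bernoulli (n + 2) / (2 * real (n + 2)))"
proof -
  define Q where "Q = {s. \<bar>Re s\<bar> < 2 * pi \<and> \<bar>Im s\<bar> < 2 * pi}"
  define reg where "reg = (\<lambda>s. kernel_reg s + lambert_even s)"
  define H where "H = (\<lambda>s. reg s + reg (\<i> * s))"
  have Q_eq: "Q = box (Complex (-2*pi) (-2*pi)) (Complex (2*pi) (2*pi))"
    by (auto simp: Q_def in_box_complex_iff)
  have "open Q" "0 \<in> Q"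
    unfolding Q_eq by (rule open_box) (simp add: in_box_complex_iff)
  have rotQ: "\<i> * s \<in> Q" if "s \<in> Q" for s
    using that by (auto simp: Q_def)
  have "reg analytic_on {s}" if "s \<in> Q" for s
    using that unfolding reg_def Q_def
    by (intro analytic_on_add kernel_reg_analytic lambert_even_analytic) auto
  then have reg: "reg holomorphic_on Q"
    by (meson analytic_imp_holomorphic analytic_on_analytic_at)
  have reg_rot: "(\<lambda>s. reg (\<i> * s)) holomorphic_on Q"
    using holomorphic_on_compose_gen[of "\<lambda>s. \<i> * s" Q reg Q] reg rotQ
    by (auto simp: o_def intro!: holomorphic_intros)
  have even: "reg (- s) = reg s" for s
    by (simp add: reg_def kernel_reg_even lambert_even_def add.commute)
  \<comment> \<open>The principal parts cancel: 1 / s^2 + 1 / (i s)^2 = 0.\<close>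
  have H_eq: "H s = lattice_sum s + lattice_sum (\<i> * s)" if "s \<noteq> 0" for s
    using that by (simp add: H_def reg_def kernel_reg_def lambert_even_def lattice_sum_def power_mult_distrib)
  have "H constant_on Q"
    unfolding Q_def
  proof (rule constant_on_square_if_periodic)
    show "H holomorphic_on {s. \<bar>Re s\<bar> < 2 * pi \<and> \<bar>Im s\<bar> < 2 * pi}"
      using holomorphic_on_add[OF reg reg_rot] by (simp add: H_def Q_def)
    show "H (\<i> * s) = H s" for s
      using even[of s] by (simp add: H_def flip: mult.assoc)
    show "H (s - of_real (2 * pi)) = H s"
      if s: "s \<in> {s. \<bar>Re s\<bar> < 2 * pi \<and> \<bar>Im s\<bar> < 2 * pi}" "Re s > 0" for s
    proof -
      \<comment> \<open>Both points avoid 0 because 0 < Re s < 2 pi, so \<open>H_eq\<close> applies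
        to them. Shifting s by the real period shifts i s by the imaginary one.\<close>
      have "s \<noteq> 0" "s - of_real (2 * pi) \<noteq> 0"
        using s by (auto simp: complex_eq_iff)
      moreover have "\<i> * (s - of_real (2 * pi)) = \<i> * s - of_real (2 * pi) * \<i>"
        by (simp add: algebra_simps)
      ultimately show ?thesis
        using s lattice_sum_shift_real[of s] lattice_sum_shift_imag[of "\<i> * s"]
        by (simp add: H_eq del: of_real_mult)
    qed
  qed simp
  then obtain c where c: "\<And>s. s \<in> Q \<Longrightarrow> H s = c"
    by (auto simp: constant_on_def)
  have "(deriv ^^ n) H 0 = (deriv ^^ n) (\<lambda>_. c) 0"
    using c \<open>open Q\<close> \<open>0 \<in> Q\<close>
    by (intro higher_deriv_cong_ev refl) (auto intro: eventually_mono[OF eventually_nhds_in_open])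
  also have "\<dots> = 0"
    using assms by simp
  finally have "(deriv ^^ n) H 0 = 0" .
  moreover have "(deriv ^^ n) H 0 = (deriv ^^ n) reg 0 + (deriv ^^ n) (\<lambda>s. reg (\<i> * s)) 0"
    unfolding H_def using reg reg_rot \<open>open Q\<close> \<open>0 \<in> Q\<close>
    by (intro higher_deriv_add) auto
  moreover have "(deriv ^^ n) (\<lambda>s. reg (\<i> * s)) 0 = (deriv ^^ n) reg 0"
  proof -
    obtain m where m: "n = 4 * m"
      using assms by blast
    have "\<i> ^ n = 1"
      by (simp add: m power_mult)
    then show ?thesis
      using higher_deriv_compose_linear[OF reg \<open>open Q\<close> \<open>open Q\<close> \<open>0 \<in> Q\<close> rotQ, of n] by simp
  qed
  moreover have "(deriv ^^ n) reg 0 = (deriv ^^ n) kernel_reg 0 + (deriv ^^ n) lambert_even 0"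
    unfolding reg_def by (intro higher_deriv_add_at kernel_reg_analytic lambert_even_analytic) auto
  moreover have "(deriv ^^ n) lambert_even 0 = 2 * eval_fps (lambert_fps (Suc n)) 1"
    using assms by (intro higher_deriv_lambert_even) auto
  moreover have "(deriv ^^ n) kernel_reg 0 = fact n * fps_nth kernel_fps n"
    using fps_nth_fps_expansion[OF kernel_reg_has_fps_expansion, of n] by simp
  \<comment> \<open>As i^n = 1, both summands of \<open>H\<close> contribute the same n-th
    derivative at 0, while that of a constant vanishes for n > 0.\<close>
  ultimately have "2 * (fact n * fps_nth kernel_fps n + 2 * eval_fps (lambert_fps (Suc n)) 1) = 0"
    by simp
  then have "fact n * fps_nth kernel_fps n + 2 * eval_fps (lambert_fps (Suc n)) 1 = 0"
    by (simp only: mult_eq_0_iff) simp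
  then have "2 * eval_fps (lambert_fps (Suc n)) 1 = - (fact n * fps_nth kernel_fps n)"
    by (simp add: eq_neg_iff_add_eq_0 add.commute)
  also have "\<dots> = of_real (fact n * (real (n + 1) * bernoulli (n + 2) / fact (n + 2)))"
    by (simp add: kernel_fps_nth del: fact_Suc)
  also have "fact n * (real (n + 1) * bernoulli (n + 2) / fact (n + 2)) = bernoulli (n + 2) / real (n + 2)"
    by (simp add: divide_simps)
  finally have "2 * eval_fps (lambert_fps (Suc n)) 1 / 2 = of_real (bernoulli (n + 2) / real (n + 2)) / of_real 2"
    by simp
  then show ?thesis
    unfolding of_real_divide[symmetric] by (simp add: divide_divide_eq_left mult.commute del: of_real_divide)
qed

subsection \<open>Reciprocals of power series with a simple zero\<close>

text \<open>By compactness a uniform e-neighbourhood of the closed ball lies in \<open>B\<close>. A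
  point of norm between a and a + e is within e of its radial projection onto the sphere of radius
  a.\<close>

lemma cball_subset_open_imp_ball_subset:
  fixes B :: "'a :: {real_normed_vector, heine_borel} set"
  assumes "open B" "cball 0 a \<subseteq> B" "a > 0"
  obtains r where "r > a" "ball 0 r \<subseteq> B"
proof -
  obtain e where e: "e > 0" "(\<Union>x\<in>cball 0 a. ball x e) \<subseteq> B"
    using compact_subset_open_imp_ball_epsilon_subset[OF compact_cball assms(1,2)] by blast
  have "z \<in> B" if "z \<in> ball 0 (a + e)" for z
  proof (cases "norm z \<le> a")
    case True
    then show ?thesis using assms by auto
  next
    case False
    define x where "x = (a / norm z) *\<^sub>R z"
    have nz: "norm z > 0"
      using False \<open>a > 0\<close> by linarith
    have "x \<in> cball 0 a"
      using \<open>a > 0\<close> nz by (simp add: x_def)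
    have "z - x = (1 - a / norm z) *\<^sub>R z"
      by (simp add: x_def algebra_simps)
    then have "norm (z - x) = (1 - a / norm z) * norm z"
      using False nz by simp
    also have "\<dots> = norm z - a"
      using nz by (simp add: field_simps)
    finally have "z \<in> ball x e"
      using that by (simp add: dist_norm norm_minus_commute)
    then show ?thesis
      using e \<open>x \<in> cball 0 a\<close> by blast
  qed
  then show ?thesis
    using e by (intro that[of "a + e"]) auto
qed

text \<open>
  Cancelling the simple zero, \<^term>\<open>K = (fps_X - fps_const \<rho>) * inverse F\<close> converges beyond
  \<^term>\<open>\<rho>\<close>, and its partial sums at \<^term>\<open>\<rho>\<close> telescope to the scaled coefficients of
  \<^term>\<open>inverse F\<close>.
\<close>
lemma fps_inverse_simple_pole_tendsto:
  fixes F :: "complex fps" and \<rho> :: complex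
  assumes rad: "norm \<rho> < fps_conv_radius F" and "\<rho> \<noteq> 0"
    and zero: "eval_fps F \<rho> = 0" and simple: "deriv (eval_fps F) \<rho> \<noteq> 0"
    and only: "\<And>z. norm z \<le> norm \<rho> \<Longrightarrow> eval_fps F z = 0 \<Longrightarrow> z = \<rho>"
  shows "(\<lambda>n. fps_nth (inverse F) n * \<rho> ^ n) \<longlonglongrightarrow> - (1 / eval_fps (fps_XD F) \<rho>)"
proof -
  define f where "f = eval_fps F"
  \<comment> \<open>The simple zero is divided out. The value at \<open>\<rho>\<close> removes the
    singularity and is non-zero because the zero is simple, so \<open>h\<close> has no zero on the
    closed disc.\<close>
  define h where "h = (\<lambda>z. if z = \<rho> then deriv f \<rho> else (f z - f \<rho>) / (z - \<rho>))"
  obtain R where R: "norm \<rho> < R" "ereal R < fps_conv_radius F"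
    using ereal_dense2[OF rad] by auto
  have "f holomorphic_on ball 0 R"
    unfolding f_def using R by (intro holomorphic_on_eval_fps ball_eball_mono) auto
  then have h: "h holomorphic_on ball 0 R"
    unfolding h_def by (intro pole_lemma_open) auto
  have fh: "f z = h z * (z - \<rho>)" for z
    using zero by (simp add: h_def f_def)
  define B where "B = {z \<in> ball 0 R. h z \<noteq> 0}"
  have "B = ball 0 R \<inter> h -` (- {0})"
    by (auto simp: B_def)
  then have "open B"
    using continuous_open_preimage[OF holomorphic_on_imp_continuous_on[OF h] open_ball, of "- {0}"]
    by (simp add: open_Compl)
  moreover have "h z \<noteq> 0" if "norm z \<le> norm \<rho>" for z
    using only[OF that] simple fh[of z] by (cases "z = \<rho>") (auto simp: h_def f_def)
  then have "cball 0 (norm \<rho>) \<subseteq> B"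
    using R by (auto simp: B_def)
  ultimately obtain r where r: "r > norm \<rho>" "ball 0 r \<subseteq> B"
    using \<open>\<rho> \<noteq> 0\<close> by (elim cball_subset_open_imp_ball_subset) auto
  define g where "g = (\<lambda>z. 1 / h z)"
  define K where "K = fps_expansion g 0"
  have g: "g holomorphic_on ball 0 r"
    unfolding g_def using r h
    by (intro holomorphic_on_divide holomorphic_on_const holomorphic_on_subset[OF h]) (auto simp: B_def)
  have "r > 0"
    using r norm_ge_zero[of \<rho>] by linarith
  then have gK: "g has_fps_expansion K"
    unfolding K_def using g by (intro has_fps_expansion_fps_expansion[of "ball 0 r"]) auto
  have fF: "f has_fps_expansion F"
    unfolding f_def using order_le_less_trans[OF _ rad, of 0]
    by (intro eval_fps_has_fps_expansion) (simp add: zero_ereal_def)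
  have "K * F = fps_X - fps_const \<rho>"
  proof (rule fps_ext)
    fix n
    have "fps_nth (K * F) n = (deriv ^^ n) (\<lambda>z. g z * f z) 0 / fact n"
      by (intro fps_nth_fps_expansion has_fps_expansion_mult gK fF)
    also have "(deriv ^^ n) (\<lambda>z. g z * f z) 0 = (deriv ^^ n) (\<lambda>z. z - \<rho>) 0"
    proof (intro higher_deriv_cong_ev refl eventually_mono[OF eventually_nhds_in_open])
      show "open (ball (0 :: complex) r)" "0 \<in> ball (0 :: complex) r"
        using \<open>r > 0\<close> by auto
      show "g z * f z = z - \<rho>" if "z \<in> ball 0 r" for z
        using that r by (auto simp: fh g_def B_def)
    qed
    also have "\<dots> / fact n = fps_nth (fps_X - fps_const \<rho>) n"
      by (rule fps_nth_fps_expansion[symmetric])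
         (intro has_fps_expansion_diff has_fps_expansion_fps_X has_fps_expansion_const)
    finally show "fps_nth (K * F) n = fps_nth (fps_X - fps_const \<rho>) n" .
  qed
  moreover have "fps_nth F 0 \<noteq> 0"
    using only[of 0] \<open>\<rho> \<noteq> 0\<close> by (auto simp: eval_fps_at_0)
  then have "F * inverse F = 1"
    by (rule inverse_mult_eq_1')
  ultimately have K: "K = (fps_X - fps_const \<rho>) * inverse F"
    by (metis mult.assoc mult.right_neutral)
  have partial: "(\<Sum>j\<le>n. fps_nth K j * \<rho> ^ j) = - \<rho> * (fps_nth (inverse F) n * \<rho> ^ n)" for n
  proof (induction n)
    case 0
    then show ?case by (simp add: K algebra_simps)
  next
    case (Suc n)
    have K_Suc: "fps_nth K (Suc n) = fps_nth (inverse F) n - \<rho> * fps_nth (inverse F) (Suc n)"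
      by (simp add: K left_diff_distrib del: fps_mult_nth_0 fps_mult_nth_1)
    show ?case
      unfolding sum.atMost_Suc Suc K_Suc by (simp add: algebra_simps)
  qed
  have gr: "g holomorphic_on eball 0 (ereal r)"
    using g by simp
  have "norm \<rho> < fps_conv_radius K"
    using conv_radius_fps_expansion[OF gr] r order_less_le_trans[of "ereal (norm \<rho>)" "ereal r"]
    by (simp add: K_def)
  then have "(\<lambda>n. \<Sum>j\<le>n. fps_nth K j * \<rho> ^ j) \<longlonglongrightarrow> eval_fps K \<rho>"
    using sums_eval_fps[of \<rho> K] by (simp add: sums_def_le)
  \<comment> \<open>\<open>K\<close> expands 1 / h, and h takes the value f'(\<open>\<rho>\<close>)
    at \<open>\<rho>\<close>. The later division by -\<open>\<rho>\<close> produces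
    \<open>\<rho>\<close> f'(\<open>\<rho>\<close>), the value of q d/dq F there.\<close>
  also have "eval_fps K \<rho> = 1 / deriv f \<rho>"
    using eval_fps_expansion'[OF gr, of \<rho>] r by (simp add: K_def g_def h_def)
  finally have "(\<lambda>n. - \<rho> * (fps_nth (inverse F) n * \<rho> ^ n)) \<longlonglongrightarrow> 1 / deriv f \<rho>"
    by (simp only: partial)
  then have "(\<lambda>n. - \<rho> * (fps_nth (inverse F) n * \<rho> ^ n) / (- \<rho>)) \<longlonglongrightarrow> (1 / deriv f \<rho>) / (- \<rho>)"
    using \<open>\<rho> \<noteq> 0\<close> by (intro tendsto_divide tendsto_const) auto
  then show ?thesis
    using \<open>\<rho> \<noteq> 0\<close> rad by (simp add: eval_fps_XD f_def mult.commute)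
qed

text \<open>As \<open>C\<close> is non-zero, quotients of consecutive scaled terms tend to 1;
  undoing the scaling gives the ratio test with limit \<open>norm \<rho>\<close>.\<close>

lemma conv_radius_eq_if_scaled_tendsto:
  fixes a :: "nat \<Rightarrow> complex"
  assumes lim: "(\<lambda>n. a n * \<rho> ^ n) \<longlonglongrightarrow> C" and "C \<noteq> 0" "\<rho> \<noteq> 0"
  shows "conv_radius a = norm \<rho>"
proof (rule conv_radius_ratio_limit_nonzero[OF refl])
  have "(\<lambda>n. norm \<rho> * norm ((a n * \<rho> ^ n) / (a (Suc n) * \<rho> ^ Suc n))) \<longlonglongrightarrow> norm \<rho> * norm (C / C)"
    using assms by (intro tendsto_intros LIMSEQ_Suc[OF lim]) auto
  also have "(\<lambda>n. norm \<rho> * norm ((a n * \<rho> ^ n) / (a (Suc n) * \<rho> ^ Suc n))) = (\<lambda>n. norm (a n) / norm (a (Suc n)))"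
    using \<open>\<rho> \<noteq> 0\<close> by (simp add: norm_mult norm_divide norm_power)
  finally show "(\<lambda>n. norm (a n) / norm (a (Suc n))) \<longlonglongrightarrow> norm \<rho>"
    using \<open>C \<noteq> 0\<close> by simp
qed (use assms in auto)

lemma asymp_equiv_if_scaled_tendsto:
  fixes a :: "nat \<Rightarrow> complex"
  assumes lim: "(\<lambda>n. a n * \<rho> ^ n) \<longlonglongrightarrow> C" and "C \<noteq> 0"
  shows "a \<sim>[sequentially] (\<lambda>n. C * \<rho> powi (- int n))"
  using assms by (intro asymp_equivI'_const) (simp_all add: power_int_minus field_simps)

subsection \<open>The Eisenstein series\<close>

text \<open>Expanding q^d / (1 - q^d) = sum_{e >= 1} q^(d e) gives a double series over d, e >= 1,
  regrouped by n = d e. All terms are non-negative, so it may be rearranged freely.\<close>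

lemma lambert_series_divisor_sigma:
  assumes q: "0 < q" "q < (1 :: real)"
    and S: "(\<lambda>d. real d ^ j * q ^ d / (1 - q ^ d)) sums S"
  shows "(\<lambda>n. real (divisor_sigma j n) * q ^ n) sums S"
proof -
  define f where "f = (\<lambda>(d, e). real d ^ j * q ^ (d * e))"
  define g where "g = (\<lambda>d. real d ^ j * q ^ d / (1 - q ^ d))"
  have "g d \<ge> 0" for d
    using q by (cases "d = 0") (auto simp: g_def power_le_one)
  then have "(g has_sum S) UNIV"
    using S by (intro sums_nonneg_imp_has_sum) (simp_all add: g_def)
  also have "(g has_sum S) UNIV \<longleftrightarrow> (g has_sum S) {1..}"
    by (intro has_sum_cong_neutral) (auto simp: g_def not_less_eq_eq)
  finally have g: "(g has_sum S) {1..}" .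
  have f: "((\<lambda>e. f (d, e)) has_sum g d) {1..}" if "d \<in> {1..}" for d
  proof -
    have "norm (q ^ d) < 1"
      using q that by (simp add: power_less_one_iff)
    then have "((\<lambda>e. real d ^ j * (q ^ d) ^ e) has_sum (real d ^ j * (q ^ d / (1 - q ^ d)))) {1..}"
      by (intro has_sum_cmult_right has_sum_geometric_from_1)
    then show ?thesis
      by (simp add: f_def g_def power_mult)
  qed
  have "(f has_sum S) ({1..} \<times> {1..})"
    using f g by (intro has_sum_SigmaI summable_on_SigmaI) (use q in \<open>auto simp: f_def summable_on_def\<close>)
  also have "?this \<longleftrightarrow> ((\<lambda>(n, d). real d ^ j * q ^ n) has_sum S) (SIGMA n:{1..}. {d. d dvd n})"
    by (rule has_sum_reindex_bij_witness[of _ "\<lambda>(n, d). (d, n div d)" "\<lambda>(d, e). (d * e, d)"])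
       (auto simp: f_def Suc_le_eq dvd_div_eq_0_iff)
  finally have "((\<lambda>n. real (divisor_sigma j n) * q ^ n) has_sum S) {1..}"
  proof (rule has_sum_SigmaD)
    show "((\<lambda>d. case (n, d) of (n, d) \<Rightarrow> real d ^ j * q ^ n) has_sum real (divisor_sigma j n) * q ^ n) {d. d dvd n}"
      if "n \<in> {1..}" for n
      using that by (intro has_sum_finiteI) (auto simp: divisor_sigma_def sum_distrib_right)
  qed
  \<comment> \<open>The index 0 adds nothing: its set of divisors is infinite, so
    \<open>divisor_sigma j 0\<close> is 0 by default.\<close>
  also have "?this \<longleftrightarrow> ((\<lambda>n. real (divisor_sigma j n) * q ^ n) has_sum S) UNIV"
    by (intro has_sum_cong_neutral) (auto simp: divisor_sigma_def not_less_eq_eq)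
  finally show ?thesis
    by (rule has_sum_imp_sums)
qed

lemma divisor_sigma_pos: "n > 0 \<Longrightarrow> divisor_sigma j n > 0"
  unfolding divisor_sigma_def by (rule sum_pos2[of _ n]) auto

lemma divisor_sigma_le: "divisor_sigma j n \<le> n ^ Suc j"
proof (cases "n = 0")
  case True
  then show ?thesis by (simp add: divisor_sigma_def)
next
  case False
  have "divisor_sigma j n \<le> (\<Sum>d\<in>{1..n}. n ^ j)"
    unfolding divisor_sigma_def using False
    by (intro order.trans[OF sum_mono sum_mono2] power_mono)
       (auto dest: dvd_imp_le intro: Suc_leI Nat.gr0I)
  then show ?thesis by simp
qed

lemma lambert_eisenstein_value:
  assumes "k \<ge> 4" "[k = 2] (mod 4)"
  shows "(\<lambda>n. real (divisor_sigma (k - 1) n) * qi ^ n) sums (bernoulli k / (2 * real k))"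
    and "bernoulli k > 0"
proof -
  \<comment> \<open>The Taylor coefficient in question has order n = k - 2.\<close>
  have "4 dvd k - 2" "k - 2 > 0"
    using assms cong_altdef_nat[of 2 k 4] by (auto simp: cong_sym_eq)
  then have val: "eval_fps (lambert_fps (k - 1)) 1 = of_real (bernoulli k / (2 * real k))"
    using lambert_value[of "k - 2"] assms by (simp add: Suc_diff_le eval_nat_numeral Suc_diff_Suc)
  define a where "a = (\<lambda>d. real d ^ (k - 1) * qi ^ d / (1 - qi ^ d))"
  have "norm (1 :: complex) < 1 / qi"
    using qi_pos qi_less_1 by simp
  from lambert_sums[OF this, of "k - 1"]
  have "(\<lambda>d. complex_of_real (a d)) sums of_real (bernoulli k / (2 * real k))"
    unfolding val by (simp add: a_def)
  then have a: "a sums (bernoulli k / (2 * real k))"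
    by (simp only: sums_of_real_iff)
  then show "(\<lambda>n. real (divisor_sigma (k - 1) n) * qi ^ n) sums (bernoulli k / (2 * real k))"
    using qi_pos qi_less_1 by (intro lambert_series_divisor_sigma) (simp_all add: a_def)
  have "0 < suminf a"
  proof (rule suminf_pos2)
    show "summable a"
      using a by (rule sums_summable)
    show "0 \<le> a d" for d
      using qi_pos qi_less_1 by (cases "d = 0") (auto simp: a_def power_le_one)
    show "0 < a 1"
      using qi_pos qi_less_1 by (simp add: a_def)
  qed
  then have "0 < bernoulli k / (2 * real k)"
    by (simp only: sums_unique[OF a])
  then show "bernoulli k > 0"
    using assms by (simp add: zero_less_divide_iff)
qed

section \<open>The Eisenstein power series and its reciprocal\<close>

lemma E_fps_nth:
  "fps_nth (E_fps k) n = (if n = 0 then 1 else - of_real (2 * real k / bernoulli k * real (divisor_sigma (k - 1) n)))"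
  by (simp add: E_fps_def)

lemma less_ereal_if_ge_1: "x < 1 \<Longrightarrow> 1 \<le> R \<Longrightarrow> ereal x < R"
  by (cases R) (auto simp: one_ereal_def)

text \<open>The coefficients grow at most polynomially, by \<open>divisor_sigma_le\<close>. The
  comparison series with coefficients n^m comes from applying q d/dq m times to the geometric
  series.\<close>

lemma conv_radius_E_fps: "fps_conv_radius (E_fps k) \<ge> 1"
  unfolding fps_conv_radius_def one_ereal_def
proof (rule conv_radius_geI_ex')
  fix r :: real assume r: "0 < r" "ereal r < ereal 1"
  define c where "c = 2 * real k / bernoulli k"
  define G where "G = (Abs_fps (\<lambda>_. 1) :: real fps)"
  have G_nth: "fps_nth ((fps_XD ^^ m) G) n = real n ^ m" for m n
    by (induction m) (simp_all add: G_def)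
  have "fps_conv_radius G \<ge> 1"
    unfolding fps_conv_radius_def one_ereal_def G_def
    by (rule conv_radius_geI_ex') (auto intro: summable_geometric)
  then have "fps_conv_radius ((fps_XD ^^ m) G) \<ge> 1" for m
    by (induction m) (use fps_conv_radius_XD order.trans in auto)
  then have "ereal (norm r) < fps_conv_radius ((fps_XD ^^ k) G)" for k
    using r by (intro less_ereal_if_ge_1) auto
  from norm_summable_fps[OF this[of "Suc (k - 1)"]]
  have "summable (\<lambda>n. \<bar>c\<bar> * (real n ^ Suc (k - 1) * r ^ n))"
    using r by (intro summable_mult) (simp add: G_nth abs_mult del: power_Suc funpow.simps)
  moreover have "norm (fps_nth (E_fps k) n * of_real r ^ n) \<le> \<bar>c\<bar> * (real n ^ Suc (k - 1) * r ^ n)" if "n \<ge> 1" for n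
  proof -
    have "real (divisor_sigma (k - 1) n) \<le> real n ^ Suc (k - 1)"
      using divisor_sigma_le[of "k - 1" n] by (metis of_nat_le_iff of_nat_power)
    then have "\<bar>c\<bar> * real (divisor_sigma (k - 1) n) * r ^ n \<le> \<bar>c\<bar> * real n ^ Suc (k - 1) * r ^ n"
      using r by (intro mult_right_mono mult_left_mono) auto
    then show ?thesis
      using r that unfolding E_fps_nth c_def[symmetric]
      by (simp add: norm_mult norm_power abs_mult mult.assoc del: power_Suc)
  qed
  ultimately show "summable (\<lambda>n. fps_nth (E_fps k) n * of_real r ^ n)"
    by (rule summable_comparison_test'[where N = 1])
qed

lemma E_fps_sums:
  assumes "norm z < 1"
  shows "(\<lambda>n. of_real (2 * real k / bernoulli k * real (divisor_sigma (k - 1) n)) * z ^ n) sums (1 - eval_fps (E_fps k) z)"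
proof -
  have "ereal (norm z) < fps_conv_radius (E_fps k)"
    using assms conv_radius_E_fps by (intro less_ereal_if_ge_1)
  from sums_eval_fps[OF this]
  have "(\<lambda>n. (if n = 0 then 1 else 0) - fps_nth (E_fps k) n * z ^ n) sums (1 - eval_fps (E_fps k) z)"
    using sums_single[of 0 "\<lambda>_. 1 :: complex"] by (intro sums_diff) auto
  \<comment> \<open>At n = 0 the left side is 1 - 1 and the right side vanishes because
    \<open>divisor_sigma\<close> is 0 there.\<close>
  also have "(\<lambda>n. (if n = 0 then 1 else 0) - fps_nth (E_fps k) n * z ^ n)
      = (\<lambda>n. of_real (2 * real k / bernoulli k * real (divisor_sigma (k - 1) n)) * z ^ n)"
    unfolding E_fps_nth by (auto simp: fun_eq_iff divisor_sigma_def)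
  finally show ?thesis .
qed

text \<open>The q^n coefficient of E_k * (1 / E_k) = 1 expresses \<open>beta k n\<close> as a
  combination of earlier ones with positive weights. The real witness lets strong induction speak of
  positivity of complex coefficients.\<close>

lemma beta_pos:
  assumes "bernoulli k > 0" "k > 0"
  shows "\<exists>b > 0. beta k n = of_real b"
proof (induction n rule: less_induct)
  case (less n)
  show ?case
  proof (cases n)
    case 0
    then show ?thesis
      by (intro exI[of _ 1]) (simp add: beta_def E_fps_nth)
  next
    case (Suc m)
    define c where "c = (\<lambda>i. 2 * real k / bernoulli k * real (divisor_sigma (k - 1) i))"
    have c: "c i > 0" if "i > 0" for i
      using assms divisor_sigma_pos[OF that] by (simp add: c_def)
    obtain b where b: "b i > 0" "beta k i = of_real (b i)" if "i < n" for i
      using less by metis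
    have "E_fps k * inverse (E_fps k) = 1"
      by (intro inverse_mult_eq_1') (simp add: E_fps_nth)
    from arg_cong[OF this, of "\<lambda>F. fps_nth F n"]
    have "(\<Sum>i = 0..n. fps_nth (E_fps k) i * beta k (n - i)) = 0"
      using Suc by (simp add: fps_mult_nth beta_def)
    then have "beta k n = - (\<Sum>i = 1..n. fps_nth (E_fps k) i * beta k (n - i))"
      by (simp add: sum.atLeast_Suc_atMost E_fps_nth eq_neg_iff_add_eq_0)
    also have "\<dots> = (\<Sum>i = 1..n. of_real (c i * b (n - i)))"
      unfolding sum_negf[symmetric] using Suc
      by (intro sum.cong refl) (simp add: E_fps_nth c_def b)
    finally have "beta k n = of_real (\<Sum>i = 1..n. c i * b (n - i))"
      by simp
    moreover have "(\<Sum>i = 1..n. c i * b (n - i)) > 0"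
      using Suc c b by (intro sum_pos) auto
    ultimately show ?thesis
      by blast
  qed
qed

theorem theorem1:
  fixes k :: nat
  assumes "k \<ge> 4" and "[k = 2] (mod 4)"
  shows "fps_conv_radius (inverse (E_fps k)) = ereal (exp (- 2 * pi))
    \<and> (\<forall>n. beta k n \<noteq> 0)
    \<and> (\<lambda>n. beta k n) \<sim>[sequentially]
        (\<lambda>n. - (1 / eval_fps (fps_XD (E_fps k)) (q_at \<i>)) * q_at \<i> powi (- int n))"
proof -
  define c where "c = (\<lambda>n. 2 * real k / bernoulli k * real (divisor_sigma (k - 1) n))"
  note val = lambert_eisenstein_value[OF assms]
  have \<rho>: "q_at \<i> = of_real qi" "norm (q_at \<i>) = qi"
    by (simp_all add: q_at_ii qi_def)
  have c_pos: "c n > 0" if "n > 0" for n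
    using val(2) assms divisor_sigma_pos[OF that] by (simp add: c_def)
  have c_nonneg: "c n \<ge> 0" for n
    using c_pos[of n] by (cases "n = 0") (auto simp: c_def divisor_sigma_def)
  \<comment> \<open>The identity sum_n sigma_{k-1}(n) q_i^n = B_k / (2k), scaled by 2k / B_k; this
    is E_k(q_i) = 0.\<close>
  have c_sums: "(\<lambda>n. c n * qi ^ n) sums 1"
    using sums_mult[OF val(1), of "2 * real k / bernoulli k"] val(2) assms
    by (simp add: c_def mult.assoc)
  have "(\<lambda>n. complex_of_real (c n * qi ^ n)) sums of_real 1"
    using c_sums by (simp only: sums_of_real_iff)
  then have "(\<lambda>n. of_real (c n) * q_at \<i> ^ n) sums 1"
    by (simp add: \<rho>)
  moreover have "(\<lambda>n. of_real (c n) * q_at \<i> ^ n) sums (1 - eval_fps (E_fps k) (q_at \<i>))"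
    unfolding c_def using qi_less_1 qi_pos by (intro E_fps_sums) (simp add: \<rho>)
  ultimately have "1 = 1 - eval_fps (E_fps k) (q_at \<i>)"
    by (rule sums_unique2)
  then have zero: "eval_fps (E_fps k) (q_at \<i>) = 0"
    by simp
  have rad: "ereal (norm (q_at \<i>)) < fps_conv_radius (E_fps k)"
    using qi_pos qi_less_1 conv_radius_E_fps by (intro less_ereal_if_ge_1) (simp_all add: \<rho>)
  have only: "z = q_at \<i>" if z: "norm z \<le> norm (q_at \<i>)" "eval_fps (E_fps k) z = 0" for z
  proof -
    have "(\<lambda>n. of_real (c n) * z ^ n) sums 1"
      using E_fps_sums[of z k] z qi_less_1 qi_pos by (simp add: c_def \<rho>)
    \<comment> \<open>Equality in \<open>Re (\<Sum>n. c n * z ^ n) \<le> (\<Sum>n. c n * qi ^ n)\<close> forces equality in each term.\<close>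
    from sums_diff[OF c_sums sums_Re[OF this]]
    have sums: "(\<lambda>n. c n * (qi ^ n - Re (z ^ n))) sums 0"
      by (simp add: algebra_simps)
    have "Re (z ^ n) \<le> qi ^ n" for n
      using complex_Re_le_cmod[of "z ^ n"] power_mono[of "norm z" qi n] z qi_pos by (simp add: \<rho> norm_power)
    then have "c n * (qi ^ n - Re (z ^ n)) \<ge> 0" for n
      using c_nonneg[of n] by simp
    \<comment> \<open>The term n = 1 suffices: it gives Re z = q_i, and |z| <= q_i then leaves no
      room for an imaginary part.\<close>
    then have "c 1 * (qi ^ 1 - Re (z ^ 1)) = 0"
      using suminf_eq_zero_iff[OF sums_summable[OF sums]] sums_unique[OF sums] by metis
    then have "Re z = qi"
      using c_pos[of 1] by simp
    moreover have "Im z = 0"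
      using z \<open>Re z = qi\<close> cmod_power2[of z] power_mono[OF z(1), of 2] qi_pos by (simp add: \<rho>)
    ultimately show ?thesis
      by (simp add: \<rho> complex_eq_iff)
  qed
  define T where "T = eval_fps (fps_XD (E_fps k)) (q_at \<i>)"
  have "ereal (norm (q_at \<i>)) < fps_conv_radius (fps_XD (E_fps k))"
    using rad fps_conv_radius_XD[of "E_fps k"] by order
  from sums_eval_fps[OF this]
  have "(\<lambda>n. fps_nth (fps_XD (E_fps k)) n * q_at \<i> ^ n) sums T"
    by (simp only: T_def)
  also have "(\<lambda>n. fps_nth (fps_XD (E_fps k)) n * q_at \<i> ^ n) = (\<lambda>n. of_real (- (real n * c n * qi ^ n)))"
  proof
    show "fps_nth (fps_XD (E_fps k)) n * q_at \<i> ^ n = of_real (- (real n * c n * qi ^ n))" for n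
      by (cases "n = 0") (simp_all add: E_fps_nth c_def \<rho>)
  qed
  finally have "(\<lambda>n. - (real n * c n * qi ^ n)) sums Re T"
    by (auto dest: sums_Re)
  from sums_minus[OF this] have T_sums: "(\<lambda>n. real n * c n * qi ^ n) sums (- Re T)"
    by simp
  \<comment> \<open>The term n = 1 is positive and no term is negative, so Re T < 0.\<close>
  have "0 < (\<Sum>n. real n * c n * qi ^ n)"
    using c_pos[of 1] qi_pos c_nonneg by (intro suminf_pos2[OF sums_summable[OF T_sums], of 1]) auto
  then have "T \<noteq> 0"
    using sums_unique[OF T_sums] by auto
  then have simple: "deriv (eval_fps (E_fps k)) (q_at \<i>) \<noteq> 0"
    using rad by (simp add: T_def eval_fps_XD)
  have nz: "q_at \<i> \<noteq> 0"
    using qi_pos by (simp add: \<rho>)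
  \<comment> \<open>This one limit, being non-zero, yields both the radius of convergence and the
    asymptotics.\<close>
  have lim: "(\<lambda>n. beta k n * q_at \<i> ^ n) \<longlonglongrightarrow> - (1 / T)"
    unfolding beta_def T_def by (rule fps_inverse_simple_pole_tendsto[OF rad nz zero simple only])
  have "fps_conv_radius (inverse (E_fps k)) = ereal (exp (- 2 * pi))"
    using conv_radius_eq_if_scaled_tendsto[OF lim] \<open>T \<noteq> 0\<close> nz
    by (simp add: fps_conv_radius_def beta_def[abs_def] \<rho> qi_def)
  moreover have "beta k n \<noteq> 0" for n
    using beta_pos[of k n] val(2) assms by auto
  moreover have "beta k \<sim>[sequentially] (\<lambda>n. - (1 / T) * q_at \<i> powi (- int n))"
    using asymp_equiv_if_scaled_tendsto[OF lim] \<open>T \<noteq> 0\<close> by simp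
  ultimately show ?thesis
    by (simp add: T_def)
qed

end
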